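(* Let $K$ be a compact and connected subgroup of $U(N)$ with Lie algebra $\mathfrak{k}$, and let $\mathfrak{t}$ be a torus algebra of $\mathfrak{k}$. Let $A \in \mathbb{C}^{N\times N}$, $A \neq 0$. Then the orbit $\mathcal{O}_K(A)$ is weakly rotationally symmetric if and only if (a) there exists $\Omega \in \mathfrak{k}$ such that $A$ is an eigenvector of the operator $\mathrm{ad}_\Omega$ to a non-zero eigenvalue; or equivalently, if and only if (b) there exist $U \in K$ and $\Delta \in \mathfrak{t}$ such that $UAU^\dagger$ is an eigenvector of the operator $\mathrm{ad}_\Delta$ to a non-zero eigenvalue.
   Context: $U(N)$ denotes the group of unitary $N\times N$ complex matrices and $\mathfrak{u}(N)$ its Lie algebra of skew-Hermitian matrices. For a compact connected subgroup $K\subset U(N)$ and $A\in\mathbb{C}^{N\times N}$, the $K$-orbit is $\mathcal{O}_K(A)=\{UAU^\dagger \mid U\in K\}$. The orbit is called weakly rotationally symmetric if $e^{i\varphi}\mathcal{O}_K(A)=\mathcal{O}_K(A)$ for all $\varphi\in\mathbb{R}$. For $\Omega\in\mathfrak{k}$, $\mathrm{ad}_\Omega:\mathbb{C}^{N\times N}\to\mathbb{C}^{N\times N}$, $X\mapsto \Omega X - X\Omega$. A torus algebra of $\mathfrak{k}$ is a maximal Abelian subalgebra of $\mathfrak{k}$. *)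

theory Defs
  imports "HOL-Analysis.Analysis"
begin

text \<open>Complex N x N matrices are represented as complex^'n^'n with 'n a finite type, N = CARD('n).\<close>

definition cadj :: "complex^'n^'n \<Rightarrow> complex^'n^'n" where
  "cadj A = (\<chi> i j. cnj (A $ j $ i))"

definition cscale :: "complex \<Rightarrow> complex^'n^'n \<Rightarrow> complex^'n^'n" where
  "cscale c A = (\<chi> i j. c * A $ i $ j)"

definition unitary_group :: "(complex^'n^'n) set" where
  "unitary_group = {U. U ** cadj U = mat 1 \<and> cadj U ** U = mat 1}"

text \<open>Matrix exponential, defined by its power series entrywise.\<close>
definition mexp :: "complex^'n^'n \<Rightarrow> complex^'n^'n" where
  "mexp A = (\<chi> i j. (\<Sum>k. ((((**) A) ^^ k) (mat 1)) $ i $ j / of_nat (fact k)))"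

definition is_subgroup_U :: "(complex^'n^'n) set \<Rightarrow> bool" where
  "is_subgroup_U K \<longleftrightarrow> K \<subseteq> unitary_group \<and> mat 1 \<in> K \<and>
     (\<forall>U\<in>K. \<forall>V\<in>K. U ** V \<in> K) \<and> (\<forall>U\<in>K. cadj U \<in> K)"

text \<open>Lie algebra of a (closed) subgroup K of U(N): all \<Omega> with exp(t\<Omega>) in K for all real t.
  These are automatically skew-Hermitian.\<close>
definition lie_alg :: "(complex^'n^'n) set \<Rightarrow> (complex^'n^'n) set" where
  "lie_alg K = {\<Omega>. \<forall>t::real. mexp (t *\<^sub>R \<Omega>) \<in> K}"

definition ad :: "complex^'n^'n \<Rightarrow> complex^'n^'n \<Rightarrow> complex^'n^'n" where
  "ad \<Omega> X = \<Omega> ** X - X ** \<Omega>"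

text \<open>A real Lie subalgebra of the real Lie algebra L that is Abelian.\<close>
definition abelian_subalg :: "(complex^'n^'n) set \<Rightarrow> (complex^'n^'n) set \<Rightarrow> bool" where
  "abelian_subalg L T \<longleftrightarrow> T \<subseteq> L \<and> subspace T \<and> (\<forall>X\<in>T. \<forall>Y\<in>T. X ** Y = Y ** X)"

text \<open>Torus algebra: maximal Abelian subalgebra.\<close>
definition torus_algebra :: "(complex^'n^'n) set \<Rightarrow> (complex^'n^'n) set \<Rightarrow> bool" where
  "torus_algebra L T \<longleftrightarrow> abelian_subalg L T \<and>
     (\<forall>T'. abelian_subalg L T' \<and> T \<subseteq> T' \<longrightarrow> T' = T)"

definition orbit :: "(complex^'n^'n) set \<Rightarrow> complex^'n^'n \<Rightarrow> (complex^'n^'n) set" where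
  "orbit K A = {U ** A ** cadj U | U. U \<in> K}"

definition weakly_rot_sym :: "(complex^'n^'n) set \<Rightarrow> complex^'n^'n \<Rightarrow> bool" where
  "weakly_rot_sym K A \<longleftrightarrow> (\<forall>\<phi>::real. cscale (cis \<phi>) ` orbit K A = orbit K A)"

text \<open>X is an eigenvector of ad_\<Omega> to a non-zero eigenvalue.\<close>
definition ad_eigvec_nonzero :: "complex^'n^'n \<Rightarrow> complex^'n^'n \<Rightarrow> bool" where
  "ad_eigvec_nonzero \<Omega> X \<longleftrightarrow> X \<noteq> 0 \<and> (\<exists>c::complex. c \<noteq> 0 \<and> ad \<Omega> X = cscale c X)"

end

theory Submission
  imports Defs
begin

text \<open>
  The exponential of matrices is obtained from the Banach algebra of matrices with the operator norm.
  If \<open>h\<^sub>n \<in> K\<close>, \<open>e\<^sub>n\<close> tends to \<open>0\<close> from above and \<open>(h\<^sub>n - 1) / e\<^sub>n\<close> tends to \<open>Y\<close>, then the powers of \<open>h\<^sub>n\<close> with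
  exponent \<open>\<lfloor>t / e\<^sub>n\<rfloor>\<close> tend to \<open>exp (t Y)\<close>, so \<open>Y\<close> lies in the Lie algebra of the closed group \<open>K\<close>.

  An eigenvector equation \<open>[\<Omega>, A] = c A\<close> integrates to \<open>exp (t \<Omega>) A exp (- t \<Omega>) = e\<^bsup>ct\<^esup> A\<close>, and unitarity
  forces \<open>c\<close> to be imaginary; so the orbit is rotationally symmetric. Conversely, let \<open>h\<^sub>n\<close> be an element of \<open>K\<close>
  closest to \<open>1\<close> among those that rotate \<open>A\<close> by the angle \<open>1 / (n + 1)\<close>. Along a subsequence \<open>h\<^sub>n\<close> tends to \<open>1\<close>
  and \<open>(h\<^sub>n - 1) / \<parallel>h\<^sub>n - 1\<parallel>\<close> tends to some \<open>Y\<close> in the Lie algebra with \<open>[Y, A] = c A\<close>. If \<open>c\<close> were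
  \<open>0\<close>, multiplying \<open>h\<^sub>n\<close> by \<open>exp (- \<parallel>h\<^sub>n - 1\<parallel> Y)\<close> would not change the rotation angle but would bring it closer to \<open>1\<close>.

  To conjugate \<open>\<Omega>\<close> into \<open>T\<close>, maximise \<open>\<langle>U \<Omega> U\<^sup>\<dagger>, Z\<rangle>\<close> over \<open>U \<in> K\<close> (Hunt): at a maximum \<open>U \<Omega> U\<^sup>\<dagger>\<close> commutes
  with \<open>Z\<close>. Doing this successively for a basis of \<open>T\<close>, each time inside the centraliser of the
  preceding basis elements, gives a conjugate of \<open>\<Omega>\<close> that commutes with \<open>T\<close>, hence lies in \<open>T\<close> by maximality.
\<close>

subsection \<open>The exponential in Banach algebras\<close>

text \<open>Telescoping one factor at a time. The sharp exponent would be \<open>k - 1\<close>;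
  since \<open>1 \<le> M\<close> it is relaxed to \<open>k\<close>, which avoids truncated
  subtraction.\<close>

lemma norm_power_diff_le:
  fixes a b :: "'a::real_normed_algebra_1"
  assumes "norm a \<le> M" "norm b \<le> M" "1 \<le> M"
  shows "norm (a ^ k - b ^ k) \<le> real k * norm (a - b) * M ^ k"
proof (induction k)
  case (Suc k)
  have "a ^ Suc k - b ^ Suc k = a ^ k * (a - b) + (a ^ k - b ^ k) * b"
    by (simp add: power_Suc2 algebra_simps del: power_Suc)
  then have "norm (a ^ Suc k - b ^ Suc k) \<le> norm (a ^ k) * norm (a - b) + norm (a ^ k - b ^ k) * norm b"
    by (metis add_mono norm_mult_ineq norm_triangle_le)
  also have "\<dots> \<le> M ^ Suc k * norm (a - b) + (real k * norm (a - b) * M ^ k) * M"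
  proof (intro add_mono mult_mono Suc.IH assms mult_nonneg_nonneg)
    have "norm (a ^ k) \<le> M ^ k"
      by (meson assms(1) norm_ge_zero norm_power_ineq order_trans power_mono)
    also have "\<dots> \<le> M ^ Suc k" using assms(3) by (simp add: power_increasing)
    finally show "norm (a ^ k) \<le> M ^ Suc k" .
  qed (use assms in auto)
  finally show ?case by (simp add: algebra_simps)
qed simp

lemma exp_difference_quotient:
  fixes Y :: "'a::{real_normed_algebra_1,banach}"
  shows "((\<lambda>t. (exp (t *\<^sub>R Y) - 1) /\<^sub>R t) \<longlongrightarrow> Y) (at 0)"
proof -
  have "((\<lambda>t. norm (exp (t *\<^sub>R Y) - 1 - t *\<^sub>R Y) / \<bar>t\<bar>) \<longlongrightarrow> 0) (at 0)"
    using exp_scaleR_has_vector_derivative_right[of Y 0 UNIV]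
    by (simp add: has_vector_derivative_def has_derivative_iff_norm)
  moreover have "\<forall>\<^sub>F t in at 0. norm (exp (t *\<^sub>R Y) - 1 - t *\<^sub>R Y) / \<bar>t\<bar> = norm ((exp (t *\<^sub>R Y) - 1) /\<^sub>R t - Y)"
    unfolding eventually_at
  proof (intro exI[of _ 1] conjI ballI impI)
    fix t :: real assume "t \<noteq> 0 \<and> dist t 0 < 1"
    then have "(exp (t *\<^sub>R Y) - 1) /\<^sub>R t - Y = (exp (t *\<^sub>R Y) - 1 - t *\<^sub>R Y) /\<^sub>R t"
      by (simp add: scaleR_diff_right)
    then show "norm (exp (t *\<^sub>R Y) - 1 - t *\<^sub>R Y) / \<bar>t\<bar> = norm ((exp (t *\<^sub>R Y) - 1) /\<^sub>R t - Y)"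
      by (simp add: divide_inverse mult.commute)
  qed simp
  ultimately have "((\<lambda>t. norm ((exp (t *\<^sub>R Y) - 1) /\<^sub>R t - Y)) \<longlongrightarrow> 0) (at 0)"
    by (simp add: tendsto_cong)
  then show ?thesis
    using LIM_zero_cancel tendsto_norm_zero_iff by blast
qed

lemma tendsto_exp_scaleR:
  fixes X :: "'a::{real_normed_algebra_1,banach}"
  assumes "(f \<longlongrightarrow> t) F"
  shows "((\<lambda>x. exp (f x *\<^sub>R X)) \<longlongrightarrow> exp (t *\<^sub>R X)) F"
proof -
  have "isCont (\<lambda>t. exp (t *\<^sub>R X)) t"
    using exp_scaleR_has_vector_derivative_right has_vector_derivative_continuous by blast
  from isCont_tendsto_compose[OF this assms] show ?thesis .
qed

lemma exp_power_scaleR: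
  fixes X :: "'a::{real_normed_algebra_1,banach}"
  shows "exp X ^ k = exp (real k *\<^sub>R X)"
proof (induction k)
  case (Suc k)
  have "exp (X + real k *\<^sub>R X) = exp X * exp (real k *\<^sub>R X)"
    by (rule exp_add_commuting) simp
  then show ?case using Suc by (simp add: scaleR_left_distrib)
qed simp

text \<open>Compare \<open>h n\<close> with \<open>b n = exp (e n *\<^sub>R Y)\<close>. Both have
  norm at most \<open>exp (e n * C)\<close> and they differ by o(e n), so by
  \<open>norm_power_diff_le\<close> their \<open>k n\<close>-th powers differ by (k n * e n) * o(1)
  * exp (k n * e n * C), which tends to 0. The powers of \<open>b n\<close> are exactly exponentials
  with parameter \<open>k n * e n\<close>.\<close>

lemma power_tendsto_exp:
  fixes h :: "nat \<Rightarrow> 'a::{real_normed_algebra_1,banach}"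
  assumes pos: "\<And>n. 0 < e n" and e0: "e \<longlonglongrightarrow> 0"
    and Y: "(\<lambda>n. (h n - 1) /\<^sub>R e n) \<longlonglongrightarrow> Y"
    and k: "(\<lambda>n. real (k n) * e n) \<longlonglongrightarrow> t"
  shows "(\<lambda>n. h n ^ k n) \<longlonglongrightarrow> exp (t *\<^sub>R Y)"
proof -
  obtain C where C: "\<And>n. norm ((h n - 1) /\<^sub>R e n) \<le> C"
    using convergent_imp_Bseq[OF convergentI[OF Y]] unfolding Bseq_def by blast
  have CY: "norm Y \<le> C"
    by (rule Lim_bounded[OF tendsto_norm[OF Y]]) (use C in auto)
  define b where "b n = exp (e n *\<^sub>R Y)" for n
  have nb: "norm (b n) \<le> exp (e n * C)" for n
  proof -
    have "norm (b n) \<le> exp (norm (e n *\<^sub>R Y))" unfolding b_def by (rule norm_exp)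
    also have "\<dots> \<le> exp (e n * C)" using CY pos[of n] by simp
    finally show ?thesis .
  qed
  have nh: "norm (h n) \<le> exp (e n * C)" for n
  proof -
    have "norm (h n) \<le> 1 + norm (h n - 1)"
      by (metis add_diff_cancel_left' diff_add_cancel norm_one norm_triangle_ineq add.commute)
    also have "norm (h n - 1) \<le> e n * C"
    proof -
      have "inverse (e n) * norm (h n - 1) \<le> C" using C[of n] pos[of n] by simp
      then show ?thesis using pos[of n] by (simp add: field_simps)
    qed
    also have "1 + e n * C \<le> exp (e n * C)" by (rule exp_ge_add_one_self)
    finally show ?thesis by simp
  qed
  have "0 \<le> C" using CY norm_ge_zero order_trans by blast
  have powb: "b n ^ k n = exp ((real (k n) * e n) *\<^sub>R Y)" for n
    unfolding b_def by (simp add: exp_power_scaleR)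
  have "filterlim e (at 0) sequentially"
    using e0 pos by (auto simp: filterlim_at intro!: always_eventually) (metis less_irrefl)
  from filterlim_compose[OF exp_difference_quotient this]
  have "(\<lambda>n. (h n - 1) /\<^sub>R e n - (b n - 1) /\<^sub>R e n) \<longlonglongrightarrow> Y - Y"
    unfolding b_def by (intro tendsto_diff Y)
  moreover have "(h n - 1) /\<^sub>R e n - (b n - 1) /\<^sub>R e n = (h n - b n) /\<^sub>R e n" for n
    by (simp add: algebra_simps)
  ultimately have d: "(\<lambda>n. (h n - b n) /\<^sub>R e n) \<longlonglongrightarrow> 0" by simp
  have "(\<lambda>n. h n ^ k n - b n ^ k n) \<longlonglongrightarrow> 0"
  proof (rule Lim_null_comparison)
    show "\<forall>\<^sub>F n in sequentially. norm (h n ^ k n - b n ^ k n)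
        \<le> (real (k n) * e n) * norm ((h n - b n) /\<^sub>R e n) * exp ((real (k n) * e n) * C)"
    proof (intro always_eventually allI)
      fix n
      have "1 \<le> exp (e n * C)" using \<open>0 \<le> C\<close> pos[of n] by simp
      from norm_power_diff_le[OF nh nb this, where k = "k n"]
      show "norm (h n ^ k n - b n ^ k n)
        \<le> (real (k n) * e n) * norm ((h n - b n) /\<^sub>R e n) * exp ((real (k n) * e n) * C)"
        using pos[of n] by (simp add: exp_of_nat_mult[symmetric] mult_ac mult.assoc[of "e n" "inverse (e n)", symmetric])
    qed
    show "(\<lambda>n. (real (k n) * e n) * norm ((h n - b n) /\<^sub>R e n) * exp ((real (k n) * e n) * C)) \<longlonglongrightarrow> 0"
      by (rule tendsto_eq_intros k d refl)+ simp
  qed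
  moreover have "(\<lambda>n. b n ^ k n) \<longlonglongrightarrow> exp (t *\<^sub>R Y)"
    unfolding powb by (rule tendsto_exp_scaleR[OF k])
  ultimately show ?thesis
    using tendsto_add by fastforce
qed

text \<open>Powers intertwine, hence so do the series. Different \<open>X\<close> and
  \<open>Y\<close> cover three uses: commutation (\<open>X = Y\<close>), conjugation by a group
  element, and eigenvectors of \<open>ad\<close>, where \<open>Y\<close> is \<open>X\<close> plus a
  scalar.\<close>

lemma exp_intertwine:
  fixes X Y A :: "'a::{real_normed_algebra_1,banach}"
  assumes "X * A = A * Y"
  shows "exp X * A = A * exp Y"
proof -
  have "X ^ k * A = A * Y ^ k" for k
  proof (induction k)
    case (Suc k)
    then show ?case by (metis assms mult.assoc power_Suc)
  qed simp
  moreover have "(\<lambda>k. (X ^ k /\<^sub>R fact k) * A) sums (exp X * A)"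
    by (intro sums_mult2 exp_converges)
  moreover have "(\<lambda>k. A * (Y ^ k /\<^sub>R fact k)) sums (A * exp Y)"
    by (intro sums_mult exp_converges)
  ultimately show ?thesis by (simp add: sums_unique2)
qed

subsection \<open>Complex matrices as a Banach algebra\<close>

text \<open>The type \<open>complex^'n^'n\<close> carries the Euclidean norm, in which the identity
  has norm sqrt N. A copy of the type can carry the operator norm, for which matrices form a unital
  Banach algebra.\<close>

typedef ('n::finite) cmat = "UNIV :: (complex^'n^'n) set"
  morphisms mat_of_cmat cmat_of_mat by simp

setup_lifting type_definition_cmat

lemma bounded_bilinear_matrix_mult:
  "bounded_bilinear ((**) :: complex^'n^'n \<Rightarrow> complex^'n^'n \<Rightarrow> complex^'n^'n)"
  unfolding bilinear_conv_bounded_bilinear[symmetric] bilinear_def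
  by (auto intro!: linearI simp: matrix_matrix_mult_def vec_eq_iff sum.distrib distrib_left distrib_right
      scaleR_sum_right)

interpretation matrix_mult:
  bounded_bilinear "(**) :: complex^'n^'n \<Rightarrow> complex^'n^'n \<Rightarrow> complex^'n^'n"
  by (rule bounded_bilinear_matrix_mult)

lemma onorm_matrix_eq_0_iff:
  "onorm ((*v) A) = 0 \<longleftrightarrow> A = 0" for A :: "complex^'n^'n"
  by (simp add: onorm_eq_0) (metis matrix_eq matrix_vector_mult_0)

instantiation cmat :: (finite) real_normed_algebra_1
begin

lift_definition zero_cmat :: "'a cmat" is 0 .
lift_definition one_cmat :: "'a cmat" is "mat 1" .
lift_definition plus_cmat :: "'a cmat \<Rightarrow> 'a cmat \<Rightarrow> 'a cmat" is "(+)" .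
lift_definition minus_cmat :: "'a cmat \<Rightarrow> 'a cmat \<Rightarrow> 'a cmat" is "(-)" .
lift_definition uminus_cmat :: "'a cmat \<Rightarrow> 'a cmat" is "uminus" .
lift_definition times_cmat :: "'a cmat \<Rightarrow> 'a cmat \<Rightarrow> 'a cmat" is "(**)" .
lift_definition scaleR_cmat :: "real \<Rightarrow> 'a cmat \<Rightarrow> 'a cmat" is "(*\<^sub>R)" .
lift_definition norm_cmat :: "'a cmat \<Rightarrow> real" is "\<lambda>A. onorm ((*v) A)" .
definition dist_cmat :: "'a cmat \<Rightarrow> 'a cmat \<Rightarrow> real" where "dist_cmat x y = norm (x - y)"
definition sgn_cmat :: "'a cmat \<Rightarrow> 'a cmat" where "sgn_cmat x = inverse (norm x) *\<^sub>R x"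
definition uniformity_cmat :: "('a cmat \<times> 'a cmat) filter"
  where "uniformity_cmat = (INF e\<in>{0 <..}. principal {(x, y). dist x y < e})"
definition open_cmat :: "'a cmat set \<Rightarrow> bool"
  where "open_cmat U \<longleftrightarrow> (\<forall>x\<in>U. eventually (\<lambda>(x', y). x' = x \<longrightarrow> y \<in> U) uniformity)"

instance
proof
  fix x y z :: "'a cmat" and a b :: real
  show "x + y + z = x + (y + z)" "x + y = y + x" "0 + x = x" "- x + x = 0" "x - y = x + - y"
    by (transfer; simp)+
  show "a *\<^sub>R (x + y) = a *\<^sub>R x + a *\<^sub>R y" "(a + b) *\<^sub>R x = a *\<^sub>R x + b *\<^sub>R x"
    "a *\<^sub>R b *\<^sub>R x = (a * b) *\<^sub>R x" "1 *\<^sub>R x = x"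
    by (transfer; simp add: algebra_simps)+
  show "x * y * z = x * (y * z)" by transfer (simp add: matrix_mul_assoc)
  show "(x + y) * z = x * z + y * z" "x * (y + z) = x * y + x * z"
    by (transfer; simp add: matrix_mult.add_left matrix_mult.add_right)+
  show "a *\<^sub>R x * y = a *\<^sub>R (x * y)" "x * a *\<^sub>R y = a *\<^sub>R (x * y)"
    by (transfer; simp add: matrix_mult.scaleR_left matrix_mult.scaleR_right)+
  show "1 * x = x" "x * 1 = x" by (transfer; simp)+
  show "0 \<noteq> (1 :: 'a cmat)" by transfer (simp add: vec_eq_iff mat_def)
  show "norm (1 :: 'a cmat) = 1"
  proof transfer
    have "(*v) (mat 1 :: complex^'a^'a) = id" by auto
    then show "onorm ((*v) (mat 1 :: complex^'a^'a)) = 1" by (simp add: onorm_id id_def)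
  qed
  show "norm x = 0 \<longleftrightarrow> x = 0" by transfer (rule onorm_matrix_eq_0_iff)
  show "norm (x + y) \<le> norm x + norm y"
  proof transfer
    fix A B :: "complex^'a^'a"
    have "(*v) (A + B) = (\<lambda>x. A *v x + B *v x)" by (auto simp: matrix_vector_mult_add_rdistrib)
    then show "onorm ((*v) (A + B)) \<le> onorm ((*v) A) + onorm ((*v) B)"
      by (simp add: onorm_triangle)
  qed
  show "norm (a *\<^sub>R x) = \<bar>a\<bar> * norm x"
  proof transfer
    fix a :: real and A :: "complex^'a^'a"
    have "(*v) (a *\<^sub>R A) = (\<lambda>x. a *\<^sub>R (A *v x))"
      by (auto simp: matrix_vector_mult_def vec_eq_iff scaleR_sum_right)
    then show "onorm ((*v) (a *\<^sub>R A)) = \<bar>a\<bar> * onorm ((*v) A)"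
      by (simp add: onorm_scaleR)
  qed
  show "norm (x * y) \<le> norm x * norm y"
  proof transfer
    fix A B :: "complex^'a^'a"
    have "(*v) (A ** B) = (*v) A \<circ> (*v) B" by (auto simp: matrix_vector_mul_assoc)
    then show "onorm ((*v) (A ** B)) \<le> onorm ((*v) A) * onorm ((*v) B)"
      by (simp add: onorm_compose)
  qed
  show "dist x y = norm (x - y)" by (rule dist_cmat_def)
qed (rule sgn_cmat_def uniformity_cmat_def open_cmat_def)+

end

section \<open>Equivalence of the operator norm and the Euclidean norm; completeness\<close>

lemma bounded_linear_cmat_of_mat: "bounded_linear (cmat_of_mat :: complex^'n^'n \<Rightarrow> 'n cmat)"
  unfolding linear_conv_bounded_linear[symmetric]
  by (rule linearI) (auto simp: plus_cmat.abs_eq scaleR_cmat.abs_eq)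

text \<open>An entry is a coordinate of the image of a unit vector, so the operator norm bounds it.
  Since the inverse map is bounded too, limits pass between the two types in both
  directions.\<close>

lemma bounded_linear_mat_of_cmat: "bounded_linear (mat_of_cmat :: 'n::finite cmat \<Rightarrow> complex^'n^'n)"
proof (rule bounded_linear_intro)
  fix x :: "'n cmat"
  have entry: "norm (mat_of_cmat x $ i $ j) \<le> norm x" for i j
  proof -
    have "norm (mat_of_cmat x $ i $ j) = norm ((mat_of_cmat x *v axis j 1) $ i)"
      by (simp add: matrix_vector_mult_def axis_def if_distrib[where f="(*) _"] cong: if_cong)
    also have "\<dots> \<le> norm (mat_of_cmat x *v axis j 1)" by (rule Finite_Cartesian_Product.norm_nth_le)
    also have "\<dots> \<le> onorm ((*v) (mat_of_cmat x)) * norm (axis j (1::complex))"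
      by (rule onorm) simp
    finally show ?thesis by (simp add: norm_cmat.rep_eq)
  qed
  have "norm (mat_of_cmat x) \<le> (\<Sum>i\<in>UNIV. norm (mat_of_cmat x $ i))"
    unfolding norm_vec_def by (rule L2_set_le_sum) simp
  also have "\<dots> \<le> (\<Sum>i\<in>UNIV. \<Sum>j\<in>UNIV. norm (mat_of_cmat x $ i $ j))"
    unfolding norm_vec_def[of "_ $ _"] by (intro sum_mono L2_set_le_sum) simp
  also have "\<dots> \<le> (\<Sum>i::'n\<in>UNIV. \<Sum>j::'n\<in>UNIV. norm x)"
    by (intro sum_mono entry)
  finally show "norm (mat_of_cmat x) \<le> norm x * (real CARD('n) * real CARD('n))"
    by (simp add: algebra_simps)
qed (simp_all add: plus_cmat.rep_eq scaleR_cmat.rep_eq)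

instance cmat :: (finite) banach
proof
  fix X :: "nat \<Rightarrow> 'a cmat"
  assume "Cauchy X"
  then have "Cauchy (\<lambda>n. mat_of_cmat (X n))"
    by (rule bounded_linear.Cauchy[OF bounded_linear_mat_of_cmat])
  then obtain L where "(\<lambda>n. mat_of_cmat (X n)) \<longlonglongrightarrow> L"
    using Cauchy_convergent convergent_def by blast
  from bounded_linear.tendsto[OF bounded_linear_cmat_of_mat this]
  show "convergent X" by (auto simp: mat_of_cmat_inverse convergent_def)
qed

lemma mexp_eq_exp: "mexp A = mat_of_cmat (exp (cmat_of_mat A))" for A :: "complex^'n^'n"
proof -
  have pow: "(((**) A) ^^ k) (mat 1) = mat_of_cmat (cmat_of_mat A ^ k)" for k
    by (induction k) (simp_all add: one_cmat.rep_eq times_cmat.rep_eq cmat_of_mat_inverse)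
  have "(\<lambda>k. mat_of_cmat (cmat_of_mat A ^ k /\<^sub>R fact k) $ i $ j) sums (mat_of_cmat (exp (cmat_of_mat A)) $ i $ j)" for i j
    by (intro bounded_linear.sums[OF bounded_linear_vec_nth] bounded_linear.sums[OF bounded_linear_mat_of_cmat]
        exp_converges)
  moreover have "mat_of_cmat (cmat_of_mat A ^ k /\<^sub>R fact k) $ i $ j
      = (((**) A) ^^ k) (mat 1) $ i $ j / of_nat (fact k)" for i j k
    by (simp add: pow scaleR_cmat.rep_eq scaleR_conv_of_real[where 'a=complex] divide_inverse mult.commute)
  ultimately show ?thesis
    by (auto simp: mexp_def vec_eq_iff sums_iff)
qed

subsection \<open>Adjoints and the matrix exponential\<close>

lemma cadj_mult: "cadj (A ** B) = cadj B ** cadj A"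
  by (simp add: cadj_def matrix_matrix_mult_def vec_eq_iff mult.commute)

lemma cadj_cadj [simp]: "cadj (cadj A) = A"
  by (simp add: cadj_def vec_eq_iff)

lemma cadj_one [simp]: "cadj (mat 1) = mat 1"
  by (auto simp add: cadj_def mat_def vec_eq_iff)

lemma bounded_linear_cadj: "bounded_linear (cadj :: complex^'n^'n \<Rightarrow> complex^'n^'n)"
  unfolding linear_conv_bounded_linear[symmetric]
  by (rule linearI) (auto simp: cadj_def vec_eq_iff)

lemma cadj_diff: "cadj (A - B) = cadj A - cadj B"
  by (simp add: cadj_def vec_eq_iff)

lemma cadj_scaleR: "cadj (r *\<^sub>R A) = r *\<^sub>R cadj A"
  by (simp add: cadj_def vec_eq_iff)

lemma bounded_bilinear_cscale: "bounded_bilinear (cscale :: complex \<Rightarrow> complex^'n^'n \<Rightarrow> complex^'n^'n)"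
  unfolding bilinear_conv_bounded_bilinear[symmetric] bilinear_def
  by (auto intro!: linearI simp: cscale_def vec_eq_iff distrib_left distrib_right)

interpretation cscale: bounded_bilinear "cscale :: complex \<Rightarrow> complex^'n^'n \<Rightarrow> complex^'n^'n"
  by (rule bounded_bilinear_cscale)

lemma cscale_mult_left: "cscale c A ** B = cscale c (A ** B)"
  by (simp add: cscale_def matrix_matrix_mult_def vec_eq_iff sum_distrib_left mult.assoc)

lemma cscale_mult_right: "A ** cscale c B = cscale c (A ** B)"
  by (simp add: cscale_def matrix_matrix_mult_def vec_eq_iff sum_distrib_left mult.left_commute)

lemma cscale_cscale: "cscale c (cscale d A) = cscale (c * d) A"
  by (simp add: cscale_def vec_eq_iff mult.assoc)

lemma cscale_one [simp]: "cscale 1 A = A"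
  by (simp add: cscale_def vec_eq_iff)

lemma cscale_eq_0_iff: "cscale c A = 0 \<longleftrightarrow> c = 0 \<or> A = 0"
  by (auto simp: cscale_def vec_eq_iff)

text \<open>This turns unitary invariance of the norm and the adjointness rule for \<open>ad\<close>
  into cyclicity of the trace.\<close>

lemma inner_eq_Re_trace: "A \<bullet> B = Re (trace (A ** cadj B))" for A B :: "complex^'n^'n"
  by (simp add: inner_vec_def trace_def matrix_matrix_mult_def cadj_def inner_complex_def)

lemma norm_unitary_mult_left:
  fixes A U :: "complex^'n^'n"
  assumes "cadj U ** U = mat 1"
  shows "norm (U ** A) = norm A"
proof -
  have "trace (U ** A ** cadj (U ** A)) = trace (A ** cadj A)"
    using assms trace_mul_sym[of U "A ** cadj A ** cadj U"]
    by (metis cadj_mult matrix_mul_assoc matrix_mul_rid)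
  then show ?thesis by (simp add: norm_eq_sqrt_inner inner_eq_Re_trace)
qed

lemma norm_cadj: "norm (cadj A) = norm A"
  by (simp add: norm_eq_sqrt_inner inner_eq_Re_trace trace_mul_sym[of A])

lemma norm_unitary_mult_right:
  fixes A U :: "complex^'n^'n"
  assumes "U ** cadj U = mat 1"
  shows "norm (A ** U) = norm A"
  using norm_unitary_mult_left[of "cadj U" "cadj A"] assms
  by (simp add: norm_cadj flip: cadj_mult)

lemma norm_cscale: "norm (cscale c A) = cmod c * norm A"
proof -
  have "cscale c A \<bullet> cscale c A = (cmod c)\<^sup>2 * (A \<bullet> A)"
    by (simp add: inner_vec_def cscale_def norm_mult power_mult_distrib sum_distrib_left flip: power2_norm_eq_inner)
  then show ?thesis by (simp add: norm_eq_sqrt_inner real_sqrt_mult)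
qed

lemma mexp_zero [simp]: "mexp 0 = mat 1"
  by (simp add: mexp_eq_exp one_cmat.rep_eq flip: zero_cmat_def)

lemma mexp_add_commuting:
  assumes "X ** Y = Y ** X"
  shows "mexp (X + Y) = mexp X ** mexp Y"
proof -
  have "exp (cmat_of_mat X + cmat_of_mat Y) = exp (cmat_of_mat X) * exp (cmat_of_mat Y)"
    by (rule exp_add_commuting) (simp add: times_cmat.abs_eq assms)
  then show ?thesis by (simp add: mexp_eq_exp times_cmat.rep_eq plus_cmat.abs_eq)
qed

lemma mexp_minus_mult: "mexp (- X) ** mexp X = mat 1"
  using mexp_add_commuting[of "- X" X] by (simp add: matrix_mult.minus_left matrix_mult.minus_right)

lemma mexp_intertwine:
  fixes A X Y :: "complex^'n^'n"
  assumes "X ** A = A ** Y"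
  shows "mexp X ** A = A ** mexp Y"
proof -
  have "exp (cmat_of_mat X) * cmat_of_mat A = cmat_of_mat A * exp (cmat_of_mat Y)"
    by (rule exp_intertwine) (simp add: times_cmat.abs_eq assms)
  from arg_cong[OF this, of mat_of_cmat] show ?thesis
    by (simp add: mexp_eq_exp times_cmat.rep_eq cmat_of_mat_inverse)
qed

lemma mexp_scalar: "mexp (cscale c (mat 1)) = cscale (exp c) (mat 1)" for c :: complex
proof -
  let ?f = "\<lambda>z. cmat_of_mat (cscale z (mat 1)) :: 'a cmat"
  have bl: "bounded_linear ?f"
    by (intro bounded_linear_compose[OF bounded_linear_cmat_of_mat] cscale.bounded_linear_left)
  have "?f c ^ k = ?f (c ^ k)" for k
    by (induction k) (simp_all add: one_cmat_def times_cmat.abs_eq cscale_mult_left cscale_cscale)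
  then have "?f (c ^ k /\<^sub>R fact k) = ?f c ^ k /\<^sub>R fact k" for k
    by (simp add: linear_scale[OF bounded_linear.linear[OF bl]])
  then have "(\<lambda>k. ?f c ^ k /\<^sub>R fact k) sums ?f (exp c)"
    using bounded_linear.sums[OF bl exp_converges[of c]] by simp
  then have "exp (?f c) = ?f (exp c)"
    using exp_converges sums_unique2 by blast
  then show ?thesis by (simp add: mexp_eq_exp cmat_of_mat_inverse)
qed

lemma tendsto_mexp_scaleR:
  assumes "(f \<longlongrightarrow> t) F"
  shows "((\<lambda>x. mexp (f x *\<^sub>R X)) \<longlongrightarrow> mexp (t *\<^sub>R X)) F"
  unfolding mexp_eq_exp scaleR_cmat.abs_eq[symmetric]
  by (intro bounded_linear.tendsto[OF bounded_linear_mat_of_cmat] tendsto_exp_scaleR assms)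

lemma mexp_difference_quotient: "((\<lambda>t. (mexp (t *\<^sub>R X) - mat 1) /\<^sub>R t) \<longlongrightarrow> X) (at 0)"
  using bounded_linear.tendsto[OF bounded_linear_mat_of_cmat exp_difference_quotient[of "cmat_of_mat X"]]
  by (simp add: mexp_eq_exp scaleR_cmat.rep_eq minus_cmat.rep_eq one_cmat.rep_eq cmat_of_mat_inverse
      flip: scaleR_cmat.abs_eq)

lemma conj_mexp_difference_quotient:
  "((\<lambda>t. (mexp (t *\<^sub>R X) ** Z ** mexp (- (t *\<^sub>R X)) - Z) /\<^sub>R t) \<longlongrightarrow> ad X Z) (at 0)"
proof -
  let ?a = "\<lambda>t. mexp (t *\<^sub>R X)" and ?b = "\<lambda>t. mexp (t *\<^sub>R (- X))"
  \<comment> \<open>Product rule by hand: a Z b - Z = (a - 1) Z b + Z (b - 1).\<close>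
  have "((\<lambda>t. ((?a t - mat 1) /\<^sub>R t) ** Z ** ?b t + Z ** ((?b t - mat 1) /\<^sub>R t))
      \<longlongrightarrow> X ** Z ** mexp (0 *\<^sub>R (- X)) + Z ** (- X)) (at 0)"
    by (intro tendsto_add matrix_mult.tendsto mexp_difference_quotient tendsto_mexp_scaleR tendsto_ident_at tendsto_const)
  moreover have "((?a t - mat 1) /\<^sub>R t) ** Z ** ?b t + Z ** ((?b t - mat 1) /\<^sub>R t)
      = (?a t ** Z ** mexp (- (t *\<^sub>R X)) - Z) /\<^sub>R t" for t
    by (simp add: matrix_mult.scaleR_left matrix_mult.scaleR_right matrix_mult.diff_left
        matrix_mult.diff_right algebra_simps)
  ultimately show ?thesis
    by (simp add: ad_def matrix_mult.minus_right)
qed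

subsection \<open>The Lie algebra of a closed group of unitary matrices\<close>

lemma is_subgroup_UD:
  assumes "is_subgroup_U K"
  shows "mat 1 \<in> K" "\<And>U V. U \<in> K \<Longrightarrow> V \<in> K \<Longrightarrow> U ** V \<in> K" "\<And>U. U \<in> K \<Longrightarrow> cadj U \<in> K"
    "\<And>U. U \<in> K \<Longrightarrow> U ** cadj U = mat 1" "\<And>U. U \<in> K \<Longrightarrow> cadj U ** U = mat 1"
  using assms by (auto simp: is_subgroup_U_def unitary_group_def)

lemma cadj_mexp_lie_alg:
  assumes K: "is_subgroup_U K" and "X \<in> lie_alg K"
  shows "cadj (mexp (t *\<^sub>R X)) = mexp (- (t *\<^sub>R X))"
proof -
  have "mexp (t *\<^sub>R X) \<in> K" using assms by (auto simp: lie_alg_def)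
  note is_subgroup_UD(4)[OF K this]
  then show ?thesis by (metis matrix_mul_assoc matrix_mul_lid matrix_mul_rid mexp_minus_mult)
qed

text \<open>Differentiate at 0 the identity saying that the adjoint of exp (t X) is its inverse exp
  (- t X).\<close>

lemma cadj_lie_alg:
  assumes K: "is_subgroup_U K" and X: "X \<in> lie_alg K"
  shows "cadj X = - X"
proof -
  have "((\<lambda>t. cadj ((mexp (t *\<^sub>R X) - mat 1) /\<^sub>R t)) \<longlongrightarrow> cadj X) (at 0)"
    by (intro bounded_linear.tendsto[OF bounded_linear_cadj] mexp_difference_quotient)
  moreover have "((\<lambda>t. (mexp (t *\<^sub>R (- X)) - mat 1) /\<^sub>R t) \<longlongrightarrow> - X) (at 0)"
    by (rule mexp_difference_quotient)
  ultimately show ?thesis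
    by (intro LIM_unique[of "\<lambda>t. (mexp (- (t *\<^sub>R X)) - mat 1) /\<^sub>R t" _ 0])
      (simp_all add: cadj_scaleR cadj_diff cadj_mexp_lie_alg[OF assms])
qed

lemma lie_alg_tangent:
  assumes K: "is_subgroup_U K" and "closed K"
    and h: "\<And>n. h n \<in> K" and pos: "\<And>n. 0 < e n" and e0: "e \<longlonglongrightarrow> 0"
    and Y: "(\<lambda>n. (h n - mat 1) /\<^sub>R e n) \<longlonglongrightarrow> Y"
  shows "Y \<in> lie_alg K"
proof -
  have nonneg: "mexp (t *\<^sub>R Y) \<in> K" if "0 \<le> t" for t
  proof -
    \<comment> \<open>Rounding down makes \<open>k n * e n\<close> differ from \<open>t\<close> by
      at most \<open>e n\<close>, as required by \<open>power_tendsto_exp\<close>.\<close>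
    define k where "k n = nat \<lfloor>t / e n\<rfloor>" for n
    have "norm (real (k n) * e n - t) \<le> e n" for n
    proof -
      have "real (k n) = of_int \<lfloor>t / e n\<rfloor>" using pos[of n] that by (simp add: k_def)
      then have "real (k n) \<le> t / e n" "t / e n < real (k n) + 1" by linarith+
      then show ?thesis using pos[of n] by (simp add: field_simps)
    qed
    then have "(\<lambda>n. real (k n) * e n - t) \<longlonglongrightarrow> 0"
      by (intro Lim_null_comparison[OF _ e0] always_eventually) auto
    then have k: "(\<lambda>n. real (k n) * e n) \<longlonglongrightarrow> t" by (rule LIM_zero_cancel)
    have "(\<lambda>n. (cmat_of_mat (h n) - 1) /\<^sub>R e n) \<longlonglongrightarrow> cmat_of_mat Y"
      using bounded_linear.tendsto[OF bounded_linear_cmat_of_mat Y]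
      by (simp add: one_cmat_def minus_cmat.abs_eq scaleR_cmat.abs_eq)
    from bounded_linear.tendsto[OF bounded_linear_mat_of_cmat power_tendsto_exp[OF pos e0 this k]]
    have "(\<lambda>n. mat_of_cmat (cmat_of_mat (h n) ^ k n)) \<longlonglongrightarrow> mexp (t *\<^sub>R Y)"
      by (simp add: mexp_eq_exp scaleR_cmat.abs_eq)
    moreover have "mat_of_cmat (cmat_of_mat (h n) ^ m) \<in> K" for n m
      by (induction m) (simp_all add: one_cmat.rep_eq times_cmat.rep_eq cmat_of_mat_inverse is_subgroup_UD[OF K] h)
    ultimately show ?thesis
      by (intro Lim_in_closed_set[OF \<open>closed K\<close>]) auto
  qed
  have "mexp (t *\<^sub>R Y) \<in> K" for t
  proof (cases "0 \<le> t")
    case False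
    then have V: "mexp (- (t *\<^sub>R Y)) \<in> K" using nonneg[of "- t"] by simp
    \<comment> \<open>Negative times follow by inversion, which in the unitary group is the
      adjoint.\<close>
    have "mexp (t *\<^sub>R Y) ** mexp (- (t *\<^sub>R Y)) = mat 1"
      using mexp_minus_mult[of "- (t *\<^sub>R Y)"] by simp
    then have "mexp (t *\<^sub>R Y) = cadj (mexp (- (t *\<^sub>R Y)))"
      by (metis V K is_subgroup_UD(4) matrix_mul_assoc matrix_mul_lid matrix_mul_rid)
    then show ?thesis using V is_subgroup_UD(3)[OF K] by simp
  qed (rule nonneg)
  then show ?thesis by (simp add: lie_alg_def)
qed

lemma lie_alg_conj:
  assumes K: "is_subgroup_U K" and U: "U \<in> K" and X: "X \<in> lie_alg K"
  shows "U ** X ** cadj U \<in> lie_alg K"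
proof -
  have "mexp (t *\<^sub>R (U ** X ** cadj U)) ** U = U ** mexp (t *\<^sub>R X)" for t
    by (rule mexp_intertwine)
      (simp add: matrix_mult.scaleR_left matrix_mult.scaleR_right is_subgroup_UD(5)[OF K U] flip: matrix_mul_assoc)
  then have "mexp (t *\<^sub>R (U ** X ** cadj U)) = U ** mexp (t *\<^sub>R X) ** cadj U" for t
    by (metis is_subgroup_UD(4)[OF K U] matrix_mul_assoc matrix_mul_rid)
  then show ?thesis using X by (simp add: lie_alg_def is_subgroup_UD[OF K] U)
qed

text \<open>The sum \<open>X + Y\<close> is the velocity at 0 of the curve exp (t X) exp (t Y) in
  \<open>K\<close>; sampling it at t = 1 / (n + 1) makes \<open>lie_alg_tangent\<close>
  applicable.\<close>

lemma subspace_lie_alg: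
  assumes K: "is_subgroup_U K" and "closed K"
  shows "subspace (lie_alg K)"
proof (rule subspaceI)
  show "0 \<in> lie_alg K" by (simp add: lie_alg_def is_subgroup_UD[OF K])
  show "c *\<^sub>R X \<in> lie_alg K" if "X \<in> lie_alg K" for c X
    using that by (simp add: lie_alg_def)
  fix X Y assume XY: "X \<in> lie_alg K" "Y \<in> lie_alg K"
  let ?e = "\<lambda>n. inverse (real (Suc n))"
  have e: "filterlim ?e (at 0) sequentially"
    using LIMSEQ_inverse_real_of_nat by (auto simp: filterlim_at)
  let ?a = "\<lambda>t. mexp (t *\<^sub>R X)" and ?b = "\<lambda>t. mexp (t *\<^sub>R Y)"
  have "((\<lambda>t. ((?a t - mat 1) /\<^sub>R t) ** ?b t + (?b t - mat 1) /\<^sub>R t) \<longlongrightarrow> X ** mexp (0 *\<^sub>R Y) + Y) (at 0)"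
    by (intro tendsto_add matrix_mult.tendsto mexp_difference_quotient tendsto_mexp_scaleR tendsto_ident_at tendsto_const)
  moreover have "((?a t - mat 1) /\<^sub>R t) ** ?b t + (?b t - mat 1) /\<^sub>R t = (?a t ** ?b t - mat 1) /\<^sub>R t" for t
    by (simp add: matrix_mult.scaleR_left matrix_mult.diff_left algebra_simps)
  ultimately have "((\<lambda>t. (?a t ** ?b t - mat 1) /\<^sub>R t) \<longlongrightarrow> X + Y) (at 0)" by simp
  from filterlim_compose[OF this e] show "X + Y \<in> lie_alg K"
    by (rule lie_alg_tangent[OF assms, rotated 3])
      (use XY LIMSEQ_inverse_real_of_nat in \<open>auto simp: lie_alg_def is_subgroup_UD[OF K]\<close>)
qed

text \<open>The bracket is the derivative at 0 of the conjugates exp (t X) Z exp (- t X). The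
  difference quotients stay in the Lie algebra, a subspace of a finite-dimensional space and
  therefore closed.\<close>

lemma ad_lie_alg:
  assumes K: "is_subgroup_U K" and "closed K" and XZ: "X \<in> lie_alg K" "Z \<in> lie_alg K"
  shows "ad X Z \<in> lie_alg K"
proof -
  have sub: "subspace (lie_alg K)" using subspace_lie_alg assms by blast
  show ?thesis
  proof (rule Lim_in_closed_set[OF closed_subspace[OF sub] _ _ conj_mexp_difference_quotient])
    have "(mexp (t *\<^sub>R X) ** Z ** mexp (- (t *\<^sub>R X)) - Z) /\<^sub>R t \<in> lie_alg K" for t
    proof -
      have "mexp (t *\<^sub>R X) \<in> K" using XZ by (simp add: lie_alg_def)
      from lie_alg_conj[OF K this XZ(2)] show ?thesis
        using sub XZ by (simp add: subspace_scale subspace_diff cadj_mexp_lie_alg[OF K])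
    qed
    then show "\<forall>\<^sub>F t in at 0. (mexp (t *\<^sub>R X) ** Z ** mexp (- (t *\<^sub>R X)) - Z) /\<^sub>R t \<in> lie_alg K" by simp
  qed simp
qed

text \<open>Cyclicity of the trace moves \<open>W\<close> across, and skew-Hermitian
  \<open>W\<close> absorbs the sign produced by the adjoint of the bracket.\<close>

lemma inner_ad:
  assumes "cadj W = - W"
  shows "ad X W \<bullet> Z = X \<bullet> ad W Z"
proof -
  have "trace (ad X W ** cadj Z) = trace (X ** (W ** cadj Z)) - trace (W ** (X ** cadj Z))"
    by (simp add: ad_def matrix_mult.diff_left trace_sub flip: matrix_mul_assoc)
  also have "trace (W ** (X ** cadj Z)) = trace (X ** (cadj Z ** W))"
    by (metis matrix_mul_assoc trace_mul_sym)
  also have "trace (X ** (W ** cadj Z)) - \<dots> = trace (X ** cadj (ad W Z))"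
    by (simp add: ad_def cadj_diff cadj_mult assms matrix_mult.diff_right matrix_mult.minus_right
        matrix_mult.minus_left trace_sub[symmetric])
  finally show ?thesis by (simp add: inner_eq_Re_trace)
qed

subsection \<open>Conjugation into a torus algebra\<close>

lemma exists_conj_commuting:
  assumes K: "is_subgroup_U K" and "compact K" and OZ: "\<Omega> \<in> lie_alg K" "Z \<in> lie_alg K"
  shows "\<exists>U\<in>K. ad (U ** \<Omega> ** cadj U) Z = 0"
proof -
  have cont: "continuous_on K (\<lambda>U. (U ** \<Omega> ** cadj U) \<bullet> Z)"
    by (intro continuous_on_inner continuous_on_const matrix_mult.continuous_on continuous_on_id
        linear_continuous_on bounded_linear_cadj)
  have "K \<noteq> {}" using is_subgroup_UD(1)[OF K] by blast
  from continuous_attains_sup[OF \<open>compact K\<close> this cont]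
  obtain U where U: "U \<in> K"
    and max: "\<And>V. V \<in> K \<Longrightarrow> (V ** \<Omega> ** cadj V) \<bullet> Z \<le> (U ** \<Omega> ** cadj U) \<bullet> Z"
    by blast
  define W where "W = U ** \<Omega> ** cadj U"
  \<comment> \<open>Perturb the maximiser in the direction \<open>X = ad W Z\<close>: the derivative
    of the inner product is \<open>ad W Z \<bullet> ad W Z\<close> by \<open>inner_ad\<close>.
    Maximality makes the quotients for t > 0 nonpositive, so this square vanishes.\<close>
  define X where "X = ad W Z"
  have W: "W \<in> lie_alg K" unfolding W_def by (rule lie_alg_conj[OF K U OZ(1)])
  have X: "X \<in> lie_alg K"
    unfolding X_def using ad_lie_alg[OF K compact_imp_closed[OF \<open>compact K\<close>] W OZ(2)] .
  have "((\<lambda>t. ((mexp (t *\<^sub>R X) ** W ** mexp (- (t *\<^sub>R X)) - W) /\<^sub>R t) \<bullet> Z) \<longlongrightarrow> ad X W \<bullet> Z) (at_right 0)"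
    by (intro tendsto_inner tendsto_const filterlim_mono[OF conj_mexp_difference_quotient]) (simp_all add: at_le)
  moreover have "\<forall>\<^sub>F t in at_right 0. ((mexp (t *\<^sub>R X) ** W ** mexp (- (t *\<^sub>R X)) - W) /\<^sub>R t) \<bullet> Z \<le> 0"
    unfolding eventually_at_filter
  proof (intro always_eventually allI impI)
    fix t :: real assume "t \<in> {0<..}"
    have "mexp (t *\<^sub>R X) \<in> K" using X by (simp add: lie_alg_def)
    from max[OF is_subgroup_UD(2)[OF K this U]]
    have "(mexp (t *\<^sub>R X) ** W ** mexp (- (t *\<^sub>R X))) \<bullet> Z \<le> W \<bullet> Z"
      by (simp add: W_def cadj_mult cadj_mexp_lie_alg[OF K X] matrix_mul_assoc)
    with \<open>t \<in> {0<..}\<close> show "((mexp (t *\<^sub>R X) ** W ** mexp (- (t *\<^sub>R X)) - W) /\<^sub>R t) \<bullet> Z \<le> 0"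
      by (simp add: inner_diff_left mult_nonneg_nonpos)
  qed
  ultimately have "ad X W \<bullet> Z \<le> 0"
    by (rule tendsto_upperbound) simp
  then have "X \<bullet> X \<le> 0"
    by (simp add: inner_ad[OF cadj_lie_alg[OF K W]] X_def)
  then have "X = 0" by (metis antisym inner_eq_zero_iff inner_ge_zero)
  then show ?thesis using U by (auto simp: X_def W_def)
qed

section \<open>Centralisers as compact subgroups\<close>

lemma commuting_mult:
  fixes X Y Z :: "complex^'n^'n"
  assumes "X ** Z = Z ** X" "Y ** Z = Z ** Y"
  shows "X ** Y ** Z = Z ** (X ** Y)"
  using assms by (metis matrix_mul_assoc)

text \<open>The induction in \<open>exists_conj_commuting_set\<close> replaces \<open>K\<close> by
  the centraliser of \<open>F\<close> in \<open>K\<close>. This and the next two lemmas show that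
  the centraliser is again a compact subgroup and provide elements of its Lie algebra.\<close>

lemma is_subgroup_U_centralizer:
  assumes K: "is_subgroup_U K"
  shows "is_subgroup_U {U \<in> K. \<forall>Z\<in>F. U ** Z = Z ** U}"
proof -
  have "cadj U ** Z = Z ** cadj U" if "U \<in> K" "U ** Z = Z ** U" for U Z
  proof -
    have "cadj U ** Z = cadj U ** (Z ** U) ** cadj U"
      using is_subgroup_UD(4)[OF K \<open>U \<in> K\<close>] by (metis matrix_mul_assoc matrix_mul_rid)
    also have "\<dots> = Z ** cadj U"
      using is_subgroup_UD(5)[OF K \<open>U \<in> K\<close>] that(2) by (metis matrix_mul_assoc matrix_mul_lid)
    finally show ?thesis .
  qed
  then show ?thesis
    using K by (auto simp: is_subgroup_U_def commuting_mult)
qed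

lemma compact_centralizer:
  assumes "compact (K :: (complex^'n^'n) set)"
  shows "compact {U \<in> K. \<forall>Z\<in>F. U ** Z = Z ** U}"
proof -
  have "closed {U. \<forall>Z\<in>F. U ** Z = Z ** U}"
    unfolding ball_simps Collect_ball_eq
    by (intro closed_INT ballI closed_Collect_eq matrix_mult.continuous_on continuous_on_const continuous_on_id)
  then have "compact (K \<inter> {U. \<forall>Z\<in>F. U ** Z = Z ** U})"
    by (rule compact_Int_closed[OF assms])
  moreover have "K \<inter> {U. \<forall>Z\<in>F. U ** Z = Z ** U} = {U \<in> K. \<forall>Z\<in>F. U ** Z = Z ** U}" by blast
  ultimately show ?thesis by simp
qed

lemma lie_alg_centralizer:
  assumes "X \<in> lie_alg K" "\<And>Z. Z \<in> F \<Longrightarrow> X ** Z = Z ** X"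
  shows "X \<in> lie_alg {U \<in> K. \<forall>Z\<in>F. U ** Z = Z ** U}"
  using assms
  by (auto simp: lie_alg_def matrix_mult.scaleR_left matrix_mult.scaleR_right intro!: mexp_intertwine)

lemma exists_conj_commuting_set:
  assumes K: "is_subgroup_U K" and "compact K" and O: "\<Omega> \<in> lie_alg K"
    and "finite F" "F \<subseteq> lie_alg K" "\<And>X Y. X \<in> F \<Longrightarrow> Y \<in> F \<Longrightarrow> X ** Y = Y ** X"
  shows "\<exists>U\<in>K. \<forall>Z\<in>F. (U ** \<Omega> ** cadj U) ** Z = Z ** (U ** \<Omega> ** cadj U)"
  using assms(4-)
proof (induction F rule: finite_induct)
  case empty
  then show ?case using is_subgroup_UD(1)[OF K] by auto
next
  case (insert Z F)
  then obtain U where U: "U \<in> K" and comm: "\<forall>Y\<in>F. (U ** \<Omega> ** cadj U) ** Y = Y ** (U ** \<Omega> ** cadj U)"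
    by auto
  \<comment> \<open>The conjugate found so far and \<open>Z\<close> both lie in the Lie algebra of
    the centraliser of \<open>F\<close>. A further conjugation by some \<open>V\<close> in it
    achieves commutation with \<open>Z\<close> without losing commutation with
    \<open>F\<close>.\<close>
  let ?K = "{U \<in> K. \<forall>Y\<in>F. U ** Y = Y ** U}"
  have "U ** \<Omega> ** cadj U \<in> lie_alg ?K"
    using comm by (intro lie_alg_centralizer lie_alg_conj[OF K U O]) auto
  moreover have "Z \<in> lie_alg ?K"
    using insert.prems by (intro lie_alg_centralizer) auto
  ultimately obtain V where V: "V \<in> ?K"
    and VZ: "ad (V ** (U ** \<Omega> ** cadj U) ** cadj V) Z = 0"
    using exists_conj_commuting[OF is_subgroup_U_centralizer[OF K] compact_centralizer[OF \<open>compact K\<close>]] by blast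
  have eq: "V ** (U ** \<Omega> ** cadj U) ** cadj V = (V ** U) ** \<Omega> ** cadj (V ** U)"
    by (simp add: cadj_mult matrix_mul_assoc)
  have "cadj V \<in> ?K" using is_subgroup_UD(3)[OF is_subgroup_U_centralizer[OF K] V] .
  then have "(V ** (U ** \<Omega> ** cadj U) ** cadj V) ** Y = Y ** (V ** (U ** \<Omega> ** cadj U) ** cadj V)" if "Y \<in> F" for Y
    using V comm that commuting_mult by blast
  with VZ show ?case
    using is_subgroup_UD(2)[OF K _ U, of V] V unfolding eq ad_def
    by (intro bexI[of _ "V ** U"]) auto
qed

lemma subspace_commutant: "subspace {X :: complex^'n^'n. X ** Y = Y ** X}"
  by (rule subspaceI)
    (auto simp: matrix_mult.add_left matrix_mult.add_right matrix_mult.scaleR_left matrix_mult.scaleR_right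
      matrix_mult.zero_left matrix_mult.zero_right)

text \<open>Commutants are subspaces, so commutation extends from generators to spans, one side
  after the other.\<close>

lemma span_commute:
  fixes S :: "(complex^'n^'n) set"
  assumes "\<And>X Y. X \<in> S \<Longrightarrow> Y \<in> S' \<Longrightarrow> X ** Y = Y ** X" "X \<in> span S" "Y \<in> span S'"
  shows "X ** Y = Y ** X"
proof -
  have *: "X ** Y = Y ** X" if "X \<in> span S" "Y \<in> S'" for X Y
    using span_minimal[OF _ subspace_commutant, of S Y] assms(1) that by blast
  then have "S' \<subseteq> {Y. Y ** X = X ** Y}" using assms(2) by force
  from span_minimal[OF this subspace_commutant] assms(3) show ?thesis by auto
qed

lemma lie_alg_conj_torus:
  assumes K: "is_subgroup_U K" and "compact K" and T: "torus_algebra (lie_alg K) T"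
    and O: "\<Omega> \<in> lie_alg K"
  shows "\<exists>U\<in>K. U ** \<Omega> ** cadj U \<in> T"
proof -
  have TK: "T \<subseteq> lie_alg K" and subT: "subspace T" and commT: "\<And>X Y. X \<in> T \<Longrightarrow> Y \<in> T \<Longrightarrow> X ** Y = Y ** X"
    and max: "\<And>T'. abelian_subalg (lie_alg K) T' \<Longrightarrow> T \<subseteq> T' \<Longrightarrow> T' = T"
    using T by (auto simp: torus_algebra_def abelian_subalg_def)
  obtain B where B: "B \<subseteq> T" "finite B" "T \<subseteq> span B"
    using basis_subspace_exists[OF subT] independent_imp_finite by (metis order_refl)
  then obtain U where U: "U \<in> K"
    and comm: "\<forall>Z\<in>B. (U ** \<Omega> ** cadj U) ** Z = Z ** (U ** \<Omega> ** cadj U)"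
    using exists_conj_commuting_set[OF K \<open>compact K\<close> O \<open>finite B\<close>] TK commT by (metis subset_eq)
  define W where "W = U ** \<Omega> ** cadj U"
  have WT: "W ** Z = Z ** W" if "Z \<in> T" for Z
    by (rule span_commute[of "{W}" B]) (use comm B that in \<open>auto simp: W_def span_base\<close>)
  \<comment> \<open>Adjoining \<open>W\<close> to \<open>T\<close> keeps the algebra Abelian, so
    maximality of \<open>T\<close> forces \<open>W\<close> into \<open>T\<close>.\<close>
  have "abelian_subalg (lie_alg K) (span (insert W T))"
    unfolding abelian_subalg_def
  proof (intro conjI ballI)
    show "span (insert W T) \<subseteq> lie_alg K"
      using TK lie_alg_conj[OF K U O] subspace_lie_alg[OF K compact_imp_closed[OF \<open>compact K\<close>]]
      by (intro span_minimal) (auto simp: W_def)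
    show "X ** Y = Y ** X" if "X \<in> span (insert W T)" "Y \<in> span (insert W T)" for X Y
      by (rule span_commute[OF _ that]) (use WT commT in auto)
  qed simp
  then have "span (insert W T) = T" by (rule max) (auto intro: span_base)
  then have "W \<in> T" by (metis insertI1 span_base)
  then show ?thesis using U by (auto simp: W_def)
qed

subsection \<open>Rotational symmetry\<close>

lemma ad_eigvec_nonzero_conj:
  assumes "cadj U ** U = mat 1" "ad_eigvec_nonzero \<Omega> A"
  shows "ad_eigvec_nonzero (U ** \<Omega> ** cadj U) (U ** A ** cadj U)"
proof -
  have cancel: "cadj U ** (U ** X) = X" for X
    by (metis assms(1) matrix_mul_assoc matrix_mul_lid)
  have "cadj U ** (U ** A ** cadj U) ** U = A"
    by (simp add: cancel assms(1) flip: matrix_mul_assoc)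
  then have "U ** A ** cadj U \<noteq> 0"
    using assms(2) by (auto simp: ad_eigvec_nonzero_def matrix_mult.zero_left matrix_mult.zero_right)
  moreover have "ad (U ** \<Omega> ** cadj U) (U ** A ** cadj U) = U ** ad \<Omega> A ** cadj U"
    by (simp add: ad_def matrix_mult.diff_left matrix_mult.diff_right cancel flip: matrix_mul_assoc)
  ultimately show ?thesis
    using assms(2) by (auto simp: ad_eigvec_nonzero_def cscale_mult_left cscale_mult_right)
qed

text \<open>The eigenvector equation reads \<Omega> A = A (\<Omega> + c 1), an intertwining
  relation; the scalar summand commutes with \<Omega> and contributes the factor exp (t c).\<close>

lemma mexp_ad_eigvec:
  assumes K: "is_subgroup_U K" and O: "\<Omega> \<in> lie_alg K" and eig: "ad \<Omega> A = cscale c A"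
  shows "mexp (t *\<^sub>R \<Omega>) ** A ** cadj (mexp (t *\<^sub>R \<Omega>)) = cscale (exp (t *\<^sub>R c)) A"
proof -
  have "\<Omega> ** A = A ** \<Omega> + cscale c A" using eig by (simp add: ad_def algebra_simps)
  then have "(t *\<^sub>R \<Omega>) ** A = A ** (t *\<^sub>R \<Omega> + cscale (t *\<^sub>R c) (mat 1))"
    by (simp add: matrix_mult.add_right matrix_mult.scaleR_left matrix_mult.scaleR_right scaleR_add_right
        cscale.scaleR_left cscale_mult_right)
  then have "mexp (t *\<^sub>R \<Omega>) ** A = A ** mexp (t *\<^sub>R \<Omega> + cscale (t *\<^sub>R c) (mat 1))"
    by (rule mexp_intertwine)
  also have "mexp (t *\<^sub>R \<Omega> + cscale (t *\<^sub>R c) (mat 1)) = cscale (exp (t *\<^sub>R c)) (mexp (t *\<^sub>R \<Omega>))"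
    by (subst mexp_add_commuting) (simp_all add: mexp_scalar cscale_mult_left cscale_mult_right)
  finally have "mexp (t *\<^sub>R \<Omega>) ** A ** cadj (mexp (t *\<^sub>R \<Omega>))
      = cscale (exp (t *\<^sub>R c)) (A ** (mexp (t *\<^sub>R \<Omega>) ** cadj (mexp (t *\<^sub>R \<Omega>))))"
    by (simp add: cscale_mult_left cscale_mult_right matrix_mul_assoc)
  also have "mexp (t *\<^sub>R \<Omega>) ** cadj (mexp (t *\<^sub>R \<Omega>)) = mat 1"
    using O is_subgroup_UD(4)[OF K] by (simp add: lie_alg_def)
  finally show ?thesis by simp
qed

lemma weakly_rot_sym_if_ad_eigvec:
  assumes K: "is_subgroup_U K" and O: "\<Omega> \<in> lie_alg K" and eig: "ad_eigvec_nonzero \<Omega> A"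
  shows "weakly_rot_sym K A"
proof -
  obtain c where "c \<noteq> 0" "A \<noteq> 0" and c: "ad \<Omega> A = cscale c A"
    using eig by (auto simp: ad_eigvec_nonzero_def)
  note act = mexp_ad_eigvec[OF K O c]
  have expK: "mexp (t *\<^sub>R \<Omega>) \<in> K" for t using O by (simp add: lie_alg_def)
  \<comment> \<open>Conjugation by a unitary matrix preserves the norm, so |exp c| = 1 and c is
    imaginary.\<close>
  have "norm (cscale (exp c) A) = norm A"
    using act[of 1] expK[of 1]
    by (metis norm_unitary_mult_left norm_unitary_mult_right is_subgroup_UD(3-5)[OF K] cadj_cadj scaleR_one)
  then have "Re c = 0" using \<open>A \<noteq> 0\<close> by (simp add: norm_cscale)
  then have Im: "Im c \<noteq> 0" using \<open>c \<noteq> 0\<close> by (simp add: complex_eq_iff)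
  have "\<exists>V\<in>K. V ** A ** cadj V = cscale (cis \<phi>) A" for \<phi>
  proof
    \<comment> \<open>The time \<phi> / Im c is the one at which the flow of \<Omega> has rotated A
      by the angle \<phi>.\<close>
    have "(\<phi> / Im c) *\<^sub>R c = \<i> * of_real \<phi>" using Im \<open>Re c = 0\<close> by (simp add: complex_eq_iff)
    then show "mexp ((\<phi> / Im c) *\<^sub>R \<Omega>) ** A ** cadj (mexp ((\<phi> / Im c) *\<^sub>R \<Omega>)) = cscale (cis \<phi>) A"
      by (simp add: act cis_conv_exp)
  qed (rule expK)
  then have rot: "cscale (cis \<phi>) B \<in> orbit K A" if B: "B \<in> orbit K A" for \<phi> B
  proof -
    obtain U where U: "U \<in> K" "B = U ** A ** cadj U" using B by (auto simp: orbit_def)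
    obtain V where V: "V \<in> K" "V ** A ** cadj V = cscale (cis \<phi>) A"
      using \<open>\<And>\<phi>. \<exists>V\<in>K. V ** A ** cadj V = cscale (cis \<phi>) A\<close> by blast
    have "cscale (cis \<phi>) B = U ** (V ** A ** cadj V) ** cadj U"
      by (simp add: U V cscale_mult_left cscale_mult_right)
    also have "\<dots> = (U ** V) ** A ** cadj (U ** V)" by (simp add: cadj_mult matrix_mul_assoc)
    finally show ?thesis using U V is_subgroup_UD(2)[OF K] by (auto simp: orbit_def)
  qed
  \<comment> \<open>Surjectivity: the preimage of B is B rotated by -\<phi>, again a point of the
    orbit.\<close>
  have "B \<in> cscale (cis \<phi>) ` orbit K A" if "B \<in> orbit K A" for \<phi> B
    by (rule image_eqI[OF _ rot[OF that, of "- \<phi>"]]) (simp add: cscale_cscale cis_mult)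
  then show ?thesis using rot by (auto simp: weakly_rot_sym_def)
qed

section \<open>From a rotationally symmetric orbit to an eigenvector\<close>

lemma ad_eigvec_if_weakly_rot_sym:
  fixes K :: "(complex^'n^'n) set"
  assumes K: "is_subgroup_U K" and "compact K" and "A \<noteq> 0" and wrs: "weakly_rot_sym K A"
  shows "\<exists>\<Omega>\<in>lie_alg K. ad_eigvec_nonzero \<Omega> A"
proof -
  \<comment> \<open>The angles lie in (0, 1], below pi, so each \<open>z n\<close> differs from 1
    while the sequence tends to 1. Writing the fibre condition as U A = z A U makes it linear in
    \<open>U\<close>, hence closed.\<close>
  define z where "z n = cis (inverse (real (Suc n)))" for n
  define S where "S n = {U \<in> K. U ** A = cscale (z n) (A ** U)}" for n
  have "S n \<noteq> {}" for n
  proof -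
    have "A \<in> orbit K A"
      using is_subgroup_UD(1)[OF K] by (auto simp: orbit_def intro!: exI[of _ "mat 1"])
    then have "cscale (z n) A \<in> orbit K A" using wrs by (auto simp: weakly_rot_sym_def z_def)
    then obtain U where U: "U \<in> K" "U ** A ** cadj U = cscale (z n) A"
      by (auto simp: orbit_def)
    have "U ** A = U ** A ** cadj U ** U"
      using is_subgroup_UD(5)[OF K U(1)] by (simp flip: matrix_mul_assoc)
    then have "U \<in> S n" using U by (simp add: S_def cscale_mult_left)
    then show ?thesis by blast
  qed
  moreover have "compact (S n)" for n
  proof -
    have "closed {U. U ** A = cscale (z n) (A ** U)}"
      by (intro closed_Collect_eq matrix_mult.continuous_on cscale.continuous_on continuous_on_const continuous_on_id)
    then have "compact (K \<inter> {U. U ** A = cscale (z n) (A ** U)})"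
      by (rule compact_Int_closed[OF \<open>compact K\<close>])
    moreover have "K \<inter> {U. U ** A = cscale (z n) (A ** U)} = S n" by (auto simp: S_def)
    ultimately show ?thesis by simp
  qed
  moreover have "continuous_on (S n) (\<lambda>U. norm (U - mat 1))" for n
    by (intro continuous_intros)
  ultimately have "\<exists>U\<in>S n. \<forall>V\<in>S n. norm (U - mat 1) \<le> norm (V - mat 1)" for n
    by (intro continuous_attains_inf)
  then obtain h where hS: "\<And>n. h n \<in> S n"
    and min: "\<And>n V. V \<in> S n \<Longrightarrow> norm (h n - mat 1) \<le> norm (V - mat 1)"
    by metis
  have hK: "h n \<in> K" and hA: "h n ** A = cscale (z n) (A ** h n)" for n
    using hS by (auto simp: S_def)
  \<comment> \<open>Multiplying by a stabiliser element of \<open>A\<close> stays in the fibre; this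
    supplies every competitor used against the minimiser \<open>h n\<close>.\<close>
  have S_mult: "V ** h n \<in> S n" if "V \<in> K" "V ** A = A ** V" for V n
  proof -
    have "V ** h n ** A = cscale (z n) ((V ** A) ** h n)"
      by (simp add: hA cscale_mult_right flip: matrix_mul_assoc)
    then show ?thesis
      using that hK is_subgroup_UD(2)[OF K] by (simp add: S_def matrix_mul_assoc)
  qed
  have z1: "z n \<noteq> 1" for n
  proof
    assume "z n = 1"
    then have "sin (inverse (real (Suc n))) = 0" by (simp add: z_def complex_eq_iff)
    moreover have "0 < inverse (real (Suc n))" "inverse (real (Suc n)) \<le> 1"
      by (simp_all add: field_simps)
    then have "0 < sin (inverse (real (Suc n)))"
      by (intro sin_gt_zero) (use pi_gt3 in linarith)+
    ultimately show False by simp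
  qed
  have zlim: "z \<longlonglongrightarrow> 1"
  proof -
    have "(\<lambda>n. cis (inverse (real (Suc n)))) \<longlonglongrightarrow> cis 0"
      by (intro tendsto_cis LIMSEQ_inverse_real_of_nat)
    then show ?thesis by (simp add: z_def[abs_def])
  qed
  have h1: "h n \<noteq> mat 1" for n
  proof
    assume "h n = mat 1"
    with hA[of n] have "cscale (z n - 1) A = 0" by (simp add: cscale.diff_left)
    with z1 \<open>A \<noteq> 0\<close> show False by (simp add: cscale_eq_0_iff)
  qed

  obtain g r where g: "g \<in> K" "strict_mono r" and r: "(h \<circ> r) \<longlonglongrightarrow> g"
    using \<open>compact K\<close> hK unfolding compact_def by blast
  have gA: "g ** A = A ** g"
  proof (rule LIMSEQ_unique)
    show "(\<lambda>n. (h \<circ> r) n ** A) \<longlonglongrightarrow> g ** A"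
      by (intro matrix_mult.tendsto r tendsto_const)
    have "(\<lambda>n. cscale ((z \<circ> r) n) (A ** (h \<circ> r) n)) \<longlonglongrightarrow> cscale 1 (A ** g)"
      by (intro cscale.tendsto matrix_mult.tendsto r tendsto_const LIMSEQ_subseq_LIMSEQ[OF zlim g(2)])
    then show "(\<lambda>n. (h \<circ> r) n ** A) \<longlonglongrightarrow> A ** g" by (simp add: hA)
  qed
  have "cadj g \<in> {U \<in> K. \<forall>Z\<in>{A}. U ** Z = Z ** U}"
    by (rule is_subgroup_UD(3)[OF is_subgroup_U_centralizer[OF K]]) (use g gA in auto)
  then have g': "cadj g \<in> K" "cadj g ** A = A ** cadj g" by auto
  \<comment> \<open>A priori the limit \<open>g\<close> is only some stabiliser element. The
    competitor \<open>cadj g ** h (r n)\<close> is as far from 1 as \<open>h (r n)\<close> is from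
    \<open>g\<close>, and this distance tends to 0; minimality then gives convergence to 1.\<close>
  have "norm ((h \<circ> r) n - mat 1) \<le> norm ((h \<circ> r) n - g)" for n
  proof -
    have "norm ((h \<circ> r) n - mat 1) \<le> norm (cadj g ** (h \<circ> r) n - mat 1)"
      using min[OF S_mult[OF g']] by simp
    also have "cadj g ** (h \<circ> r) n - mat 1 = cadj g ** ((h \<circ> r) n - g)"
      by (simp add: matrix_mult.diff_right is_subgroup_UD(5)[OF K g(1)])
    also have "norm \<dots> = norm ((h \<circ> r) n - g)"
      by (rule norm_unitary_mult_left) (simp add: is_subgroup_UD(4)[OF K g(1)])
    finally show ?thesis .
  qed
  then have e0: "(\<lambda>n. norm ((h \<circ> r) n - mat 1)) \<longlonglongrightarrow> 0"
    by (intro Lim_null_comparison[OF _ tendsto_norm_zero[OF LIM_zero[OF r]]] always_eventually) simp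

  let ?y = "\<lambda>n. ((h \<circ> r) n - mat 1) /\<^sub>R norm ((h \<circ> r) n - mat 1)"
  \<comment> \<open>The normalised directions are unit vectors, so compactness of the sphere yields
    a second subsequence along which they converge.\<close>
  have "seq_compact (sphere 0 1 :: (complex^'n^'n) set)"
    by (simp flip: compact_eq_seq_compact_metric)
  moreover have "\<forall>n. ?y n \<in> sphere 0 1"
    using h1 by simp
  ultimately obtain Y q where "strict_mono q" and q: "(?y \<circ> q) \<longlonglongrightarrow> Y"
    by (rule seq_compactE)
  define k where "k n = h (r (q n))" for n
  define w where "w n = z (r (q n))" for n
  define e where "e n = norm (k n - mat 1)" for n
  have kK: "k n \<in> K" and kA: "k n ** A = cscale (w n) (A ** k n)" for n
    by (simp_all add: k_def w_def hK hA)
  have epos: "0 < e n" for n using h1 by (simp add: e_def k_def)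
  have elim: "e \<longlonglongrightarrow> 0"
    using LIMSEQ_subseq_LIMSEQ[OF e0 \<open>strict_mono q\<close>] by (simp add: e_def[abs_def] k_def o_def)
  have Ylim: "(\<lambda>n. (k n - mat 1) /\<^sub>R e n) \<longlonglongrightarrow> Y"
    using q by (simp add: e_def k_def o_def)
  have Y: "Y \<in> lie_alg K"
    by (rule lie_alg_tangent[OF K compact_imp_closed[OF \<open>compact K\<close>] kK epos elim Ylim])
  have "(\<lambda>n. k n - mat 1) \<longlonglongrightarrow> 0"
    using elim by (simp add: e_def[abs_def] tendsto_norm_zero_iff)
  then have klim: "k \<longlonglongrightarrow> mat 1" by (rule LIM_zero_cancel)

  \<comment> \<open>Approximate eigenvalues: since k A = w A k, bracketing the quotient (k - 1) / e
    with \<open>A\<close> gives c A k.\<close>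
  define c where "c n = (w n - 1) /\<^sub>R e n" for n
  have "cscale (c n) A = ad ((k n - mat 1) /\<^sub>R e n) A ** cadj (k n)" for n
  proof -
    have "ad ((k n - mat 1) /\<^sub>R e n) A = cscale (c n) (A ** k n)"
      by (simp add: ad_def c_def matrix_mult.scaleR_left matrix_mult.scaleR_right matrix_mult.diff_left
          matrix_mult.diff_right kA cscale.scaleR_left cscale.diff_left algebra_simps)
    then show ?thesis
      by (simp add: cscale_mult_left is_subgroup_UD(4)[OF K kK] flip: matrix_mul_assoc)
  qed
  moreover have "(\<lambda>n. ad ((k n - mat 1) /\<^sub>R e n) A ** cadj (k n)) \<longlonglongrightarrow> ad Y A ** cadj (mat 1)"
    unfolding ad_def
    by (intro matrix_mult.tendsto tendsto_diff Ylim tendsto_const bounded_linear.tendsto[OF bounded_linear_cadj] klim)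
  ultimately have cA: "(\<lambda>n. cscale (c n) A) \<longlonglongrightarrow> ad Y A" by simp
  \<comment> \<open>A nonzero entry of \<open>A\<close> recovers the scalars \<open>c n\<close> from
    the matrices c A, so they converge and the limit \<open>ad Y A\<close> is a multiple of
    \<open>A\<close>.\<close>
  obtain i j where ij: "A $ i $ j \<noteq> 0" using \<open>A \<noteq> 0\<close> by (auto simp: vec_eq_iff)
  have "(\<lambda>n. cscale (c n) A $ i $ j / A $ i $ j) \<longlonglongrightarrow> ad Y A $ i $ j / A $ i $ j"
    by (intro tendsto_divide tendsto_vec_nth cA tendsto_const ij)
  then have "c \<longlonglongrightarrow> ad Y A $ i $ j / A $ i $ j" using ij by (simp add: cscale_def)
  then have "(\<lambda>n. cscale (c n) A) \<longlonglongrightarrow> cscale (ad Y A $ i $ j / A $ i $ j) A"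
    by (intro cscale.tendsto tendsto_const)
  then obtain d where d: "ad Y A = cscale d A" using LIMSEQ_unique[OF cA] by blast
  have "d \<noteq> 0"
  proof
    assume "d = 0"
    \<comment> \<open>then \<open>mexp (- e n *\<^sub>R Y) ** k n\<close> lies in the same fibre as the minimiser \<open>k n\<close>,
       but at distance \<open>o (e n)\<close> from the identity\<close>
    have comm: "mexp (t *\<^sub>R Y) ** A = A ** mexp (t *\<^sub>R Y)" for t
      using d \<open>d = 0\<close>
      by (intro mexp_intertwine) (simp add: ad_def matrix_mult.scaleR_left matrix_mult.scaleR_right cscale.zero_left)
    have "1 \<le> norm ((k n - mat 1) /\<^sub>R e n - (mexp (e n *\<^sub>R Y) - mat 1) /\<^sub>R e n)" for n
    proof -
      have V: "mexp (e n *\<^sub>R Y) \<in> K" "mexp (- (e n *\<^sub>R Y)) \<in> K"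
        using Y unfolding lie_alg_def by (auto simp flip: scaleR_minus_left)
      have "mexp (- (e n *\<^sub>R Y)) ** A = A ** mexp (- (e n *\<^sub>R Y))"
        using comm[of "- e n"] by simp
      then have "e n \<le> norm (mexp (- (e n *\<^sub>R Y)) ** k n - mat 1)"
        using min[OF S_mult[OF V(2)]] by (simp add: e_def k_def)
      also have "mexp (- (e n *\<^sub>R Y)) ** k n - mat 1 = mexp (- (e n *\<^sub>R Y)) ** (k n - mexp (e n *\<^sub>R Y))"
        by (simp add: matrix_mult.diff_right mexp_minus_mult)
      also have "norm \<dots> = norm (k n - mexp (e n *\<^sub>R Y))"
        by (rule norm_unitary_mult_left[OF is_subgroup_UD(5)[OF K V(2)]])
      finally have "1 \<le> norm (k n - mexp (e n *\<^sub>R Y)) / e n"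
        using epos[of n] by simp
      also have "\<dots> = norm ((k n - mexp (e n *\<^sub>R Y)) /\<^sub>R e n)"
        using epos[of n] by (simp add: divide_inverse mult.commute)
      finally show ?thesis by (simp add: scaleR_diff_right)
    qed
    moreover have "filterlim e (at 0) sequentially"
      using elim epos by (auto simp: filterlim_at intro!: always_eventually) (metis less_irrefl)
    then have "(\<lambda>n. norm ((k n - mat 1) /\<^sub>R e n - (mexp (e n *\<^sub>R Y) - mat 1) /\<^sub>R e n)) \<longlonglongrightarrow> norm (Y - Y)"
      by (intro tendsto_norm tendsto_diff Ylim filterlim_compose[OF mexp_difference_quotient])
    ultimately have "1 \<le> norm (Y - Y)" by (intro Lim_bounded2) auto
    then show False by simp
  qed
  with d Y \<open>A \<noteq> 0\<close> show ?thesis by (auto simp: ad_eigvec_nonzero_def)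
qed

theorem theorem2p15:
  fixes K :: "(complex^'n^'n) set" and T :: "(complex^'n^'n) set" and A :: "complex^'n^'n"
  assumes "is_subgroup_U K" and "compact K" and "connected K"
    and "torus_algebra (lie_alg K) T"
    and "A \<noteq> 0"
  shows "(weakly_rot_sym K A \<longleftrightarrow> (\<exists>\<Omega>\<in>lie_alg K. ad_eigvec_nonzero \<Omega> A))
       \<and> (weakly_rot_sym K A \<longleftrightarrow>
           (\<exists>U\<in>K. \<exists>\<Delta>\<in>T. ad_eigvec_nonzero \<Delta> (U ** A ** cadj U)))"
proof -
  note K = assms(1)
  have a: "weakly_rot_sym K A \<longleftrightarrow> (\<exists>\<Omega>\<in>lie_alg K. ad_eigvec_nonzero \<Omega> A)"
    using ad_eigvec_if_weakly_rot_sym[OF assms(1,2,5)] weakly_rot_sym_if_ad_eigvec[OF K] by blast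
  \<comment> \<open>Conjugating operator and eigenvector simultaneously preserves the eigenvector
    equation: \<open>U\<close> carries \<Omega> into \<open>T\<close>, and \<open>cadj U\<close>
    leads back from \<Delta> to an element of the Lie algebra.\<close>
  have "(\<exists>\<Omega>\<in>lie_alg K. ad_eigvec_nonzero \<Omega> A) \<longleftrightarrow>
      (\<exists>U\<in>K. \<exists>\<Delta>\<in>T. ad_eigvec_nonzero \<Delta> (U ** A ** cadj U))"
  proof safe
    fix \<Omega> assume O: "\<Omega> \<in> lie_alg K" "ad_eigvec_nonzero \<Omega> A"
    obtain U where U: "U \<in> K" "U ** \<Omega> ** cadj U \<in> T"
      using lie_alg_conj_torus[OF assms(1,2,4) O(1)] by blast
    then show "\<exists>U\<in>K. \<exists>\<Delta>\<in>T. ad_eigvec_nonzero \<Delta> (U ** A ** cadj U)"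
      using ad_eigvec_nonzero_conj[OF is_subgroup_UD(5)[OF K U(1)] O(2)] by blast
  next
    fix U \<Delta> assume U: "U \<in> K" and D: "\<Delta> \<in> T" "ad_eigvec_nonzero \<Delta> (U ** A ** cadj U)"
    have "\<Delta> \<in> lie_alg K"
      using D(1) assms(4) by (auto simp: torus_algebra_def abelian_subalg_def)
    then have "cadj U ** \<Delta> ** cadj (cadj U) \<in> lie_alg K"
      by (rule lie_alg_conj[OF K is_subgroup_UD(3)[OF K U]])
    moreover have "cadj U ** (U ** A ** cadj U) ** cadj (cadj U) = A"
      using is_subgroup_UD(5)[OF K U] by (metis cadj_cadj matrix_mul_assoc matrix_mul_lid matrix_mul_rid)
    then have "ad_eigvec_nonzero (cadj U ** \<Delta> ** cadj (cadj U)) A"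
      using ad_eigvec_nonzero_conj[of "cadj U", OF _ D(2)] is_subgroup_UD(4)[OF K U] by simp
    ultimately show "\<exists>\<Omega>\<in>lie_alg K. ad_eigvec_nonzero \<Omega> A" by blast
  qed
  with a show ?thesis by simp
qed

end
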